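(* For every integer $a\geq 3$, $S(a)=T(a)\cup\{l_a,\,2l_a+1\}$. Moreover, $T(a)\cap\{l_a,\,2l_a+1\}=\emptyset$.
   Context: $\mathbb{N}=\{0,1,2,\ldots\}$. The Lucas series $\{l_n\}_{n\in\mathbb{N}}$ is defined by $l_0=2$, $l_1=1$, $l_{n+2}=l_{n+1}+l_n$. For $a\in\mathbb{N}$, $S(a)$ is the submonoid of $(\mathbb{N},+)$ generated by $\{l_a\}\cup\{l_a+l_n\mid n\in\mathbb{N}\}$, and $T(a)$ is the submonoid of $(\mathbb{N},+)$ generated by $\{l_a+l_n\mid n\in\mathbb{N}\}$. *)

theory Defs
  imports Main "HOL.Hull"
begin

fun lucas :: "nat \<Rightarrow> nat" where
  "lucas 0 = 2"
| "lucas (Suc 0) = 1"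
| "lucas (Suc (Suc n)) = lucas (Suc n) + lucas n"

definition add_submonoid :: "'a::monoid_add set \<Rightarrow> bool" where
  "add_submonoid M \<longleftrightarrow> 0 \<in> M \<and> (\<forall>x\<in>M. \<forall>y\<in>M. x + y \<in> M)"

definition lucas_S :: "nat \<Rightarrow> nat set" where
  "lucas_S a = add_submonoid hull ({lucas a} \<union> {lucas a + lucas n | n. True})"

definition lucas_T :: "nat \<Rightarrow> nat set" where
  "lucas_T a = add_submonoid hull {lucas a + lucas n | n. True}"

end

theory Submission
  imports Defs
begin

text \<open>
  Write \<open>L\<close> for the Lucas number at \<open>a\<close>. As \<open>l\<^sub>n\<close> is a sum of two Lucas numbers unless \<open>n = 1\<close>,
  the number \<open>L + (L + l\<^sub>n)\<close> is a sum of two generators of \<open>T(a)\<close> unless \<open>n = 1\<close>, when it is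
  \<open>2L + 1\<close>; and \<open>L + 2(L + 1) = (L + L) + (L + 2)\<close>. So adding \<open>L\<close> to an element of \<open>T(a)\<close> leaves
  \<open>T(a)\<close> only at \<open>0\<close> and \<open>L + 1\<close>. Conversely, sums of two generators are at least \<open>2L + 2\<close>, and
  \<open>L + 1\<close> is not a Lucas number because the gap after \<open>L\<close> is at least \<open>3\<close>.
\<close>

lemma add_submonoid_hull: "add_submonoid (add_submonoid hull X)"
  by (rule hull_in) (auto simp: add_submonoid_def)

lemma zero_in_hull: "0 \<in> add_submonoid hull X"
  and add_in_hull: "x \<in> add_submonoid hull X \<Longrightarrow> y \<in> add_submonoid hull X
    \<Longrightarrow> x + y \<in> add_submonoid hull X"
  using add_submonoid_hull[of X] by (auto simp: add_submonoid_def)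

text \<open>The elements of the hull that satisfy \<open>P\<close> form a submonoid containing
  \<open>X\<close>. Hull membership is kept in the \<open>add\<close> case because absorbing
  \<open>lucas a\<close> into one summand needs the other to lie in
  \<open>lucas_T a\<close>.\<close>

lemma add_submonoid_hull_induct [consumes 1, case_names generator zero add]:
  assumes "x \<in> add_submonoid hull X"
    and "\<And>x. x \<in> X \<Longrightarrow> P x"
    and "P 0"
    and "\<And>x y. x \<in> add_submonoid hull X \<Longrightarrow> y \<in> add_submonoid hull X \<Longrightarrow> P x \<Longrightarrow> P y \<Longrightarrow> P (x + y)"
  shows "P x"
proof -
  have "add_submonoid hull X \<subseteq> {x \<in> add_submonoid hull X. P x}"
    using assms(2-4)
    by (intro hull_minimal)
      (auto simp: add_submonoid_def hull_inc intro: zero_in_hull add_in_hull)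
  then show ?thesis using assms(1) by blast
qed

lemma lucas_pos: "lucas n > 0"
  by (induction n rule: lucas.induct) auto

text \<open>Index 0 is excluded because the sequence starts with the descent 2, 1.\<close>

lemma lucas_mono: "m \<le> n \<Longrightarrow> 1 \<le> m \<Longrightarrow> lucas m \<le> lucas n"
proof (induction rule: dec_induct)
  case (step k)
  then obtain j where "k = Suc j" by (cases k) auto
  with step show ?case by auto
qed simp

lemma lucas_neq_Suc_lucas:
  assumes "a \<ge> 3"
  shows "lucas n \<noteq> Suc (lucas a)"
proof -
  have ge: "lucas a \<ge> 4"
    using lucas_mono[of 3 a] assms by (simp add: eval_nat_numeral)
  obtain b where b: "a = Suc b" "b \<ge> 2"
    using assms by (cases a) auto
  have "lucas b \<ge> 3"
    using lucas_mono[of 2 b] b by (simp add: eval_nat_numeral)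
  then have gap: "lucas (Suc a) \<ge> lucas a + 3"
    using b by simp
  consider "n = 0" | "1 \<le> n" "n \<le> a" | "Suc a \<le> n" by linarith
  then show ?thesis
    using ge gap lucas_mono[of n a] lucas_mono[of "Suc a" n] by cases auto
qed

lemma generator_in_T: "lucas a + lucas n \<in> lucas_T a"
  unfolding lucas_T_def by (rule hull_inc) auto

lemma zero_in_T: "0 \<in> lucas_T a"
  and add_in_T: "x \<in> lucas_T a \<Longrightarrow> y \<in> lucas_T a \<Longrightarrow> x + y \<in> lucas_T a"
  unfolding lucas_T_def by (rule zero_in_hull, rule add_in_hull)

lemma lucas_add_T:
  assumes "t \<in> lucas_T a"
  shows "lucas a + t \<in> lucas_T a \<or> t = 0 \<or> t = lucas a + 1"
  using assms unfolding lucas_T_def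
proof (induction rule: add_submonoid_hull_induct)
  case (generator x)
  then obtain n where n: "x = lucas a + lucas n" by auto
  show ?case
  proof (cases n rule: lucas.cases)
    case 1
    \<comment> \<open>Here \<open>lucas 0 = lucas 1 + lucas 1\<close> replaces the
      recurrence.\<close>
    then show ?thesis
      using n add_in_T[OF generator_in_T[of a 1] generator_in_T[of a 1]]
      by (simp add: lucas_T_def)
  next
    case 2
    then show ?thesis using n by simp
  next
    case (3 k)
    then show ?thesis
      using n add_in_T[OF generator_in_T[of a "Suc k"] generator_in_T[of a k]]
      by (simp add: lucas_T_def ac_simps)
  qed
next
  case (add x y)
  \<comment> \<open>This settles \<open>x = y = lucas a + 1\<close>, the only case in which both
    summands are nonzero and neither absorbs \<open>lucas a\<close>.\<close>
  have "(lucas a + lucas a) + (lucas a + lucas 0) \<in> lucas_T a"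
    by (intro add_in_T generator_in_T)
  then have "lucas a + ((lucas a + 1) + (lucas a + 1)) \<in> lucas_T a"
    by (simp add: ac_simps)
  moreover have "lucas a + x \<in> lucas_T a \<Longrightarrow> lucas a + (x + y) \<in> lucas_T a"
    "lucas a + y \<in> lucas_T a \<Longrightarrow> lucas a + (x + y) \<in> lucas_T a"
    using add_in_T[of "lucas a + x" a y] add_in_T[of "lucas a + y" a x] add.hyps
    by (simp_all add: lucas_T_def ac_simps)
  ultimately show ?case
    using add.IH unfolding lucas_T_def[symmetric] by auto
qed simp

lemma T_cases:
  assumes "t \<in> lucas_T a"
  shows "t = 0 \<or> (\<exists>n. t = lucas a + lucas n) \<or> t \<ge> 2 * lucas a + 2"
  using assms unfolding lucas_T_def
proof (induction rule: add_submonoid_hull_induct)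
  case (add x y)
  \<comment> \<open>Lucas numbers are positive, so two nonzero summands contribute at least
    \<open>lucas a + 1\<close> each.\<close>
  have "z = 0 \<or> z \<ge> lucas a + 1"
    if "z = 0 \<or> (\<exists>n. z = lucas a + lucas n) \<or> z \<ge> 2 * lucas a + 2" for z
    using that lucas_pos by (force simp: Suc_le_eq)
  from this[OF add.IH(1)] this[OF add.IH(2)] add.IH show ?case by auto
qed auto

theorem proposition7p5:
  fixes a :: nat
  assumes "a \<ge> 3"
  shows "lucas_S a = lucas_T a \<union> {lucas a, 2 * lucas a + 1}
       \<and> lucas_T a \<inter> {lucas a, 2 * lucas a + 1} = {}"
proof (intro conjI equalityI)
  let ?L = "lucas a" and ?U = "lucas_T a \<union> {lucas a, 2 * lucas a + 1}"
  have double: "?L + ?L \<in> lucas_T a" and succ: "?L + 1 \<in> lucas_T a"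
    using generator_in_T[of a a] generator_in_T[of a 1] by auto
  \<comment> \<open>The exceptions \<open>t = 0\<close> and \<open>t = ?L + 1\<close> yield exactly
    the two adjoined elements.\<close>
  have shift: "?L + t \<in> ?U" if "t \<in> lucas_T a" for t
    using lucas_add_T[OF that] by auto
  \<comment> \<open>As \<open>2 * ?L + 1 = ?L + (?L + 1)\<close>, this is \<open>shift\<close>
    applied to \<open>(?L + 1) + t\<close>.\<close>
  have shift2: "2 * ?L + 1 + t \<in> ?U" if "t \<in> lucas_T a" for t
    using shift[OF add_in_T[OF succ that]] by (simp add: mult_2 add.assoc)
  \<comment> \<open>The last two are \<open>2 * ?L\<close> plus one or two copies of
    \<open>?L + 1\<close>.\<close>
  have sums: "2 * ?L \<in> lucas_T a" "?L + (2 * ?L + 1) \<in> lucas_T a"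
    "2 * ?L + 1 + (2 * ?L + 1) \<in> lucas_T a"
    using double add_in_T[OF double succ]
      add_in_T[OF add_in_T[OF double succ] succ]
    by (simp_all add: mult_2 add.assoc)
  have "x + y \<in> ?U" if "x \<in> ?U" "y \<in> ?U" for x y
  proof -
    consider "x \<in> lucas_T a" "y \<in> lucas_T a" | "x \<in> lucas_T a" "y = ?L"
      | "x \<in> lucas_T a" "y = 2 * ?L + 1" | "x = ?L" "y \<in> lucas_T a"
      | "x = 2 * ?L + 1" "y \<in> lucas_T a"
      | "x \<in> {?L, 2 * ?L + 1}" "y \<in> {?L, 2 * ?L + 1}"
      using \<open>x \<in> ?U\<close> \<open>y \<in> ?U\<close> by auto
    then show ?thesis
    proof cases
      case 1
      then show ?thesis by (auto intro: add_in_T)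
    next
      case 2
      then show ?thesis using shift[of x] by (simp add: add.commute)
    next
      case 3
      then show ?thesis using shift2[of x] by (simp add: add.commute)
    next
      case 4
      then show ?thesis using shift[of y] by simp
    next
      case 5
      then show ?thesis using shift2[of y] by simp
    next
      case 6
      then show ?thesis using sums by (auto simp: mult_2 add.assoc)
    qed
  qed
  then have "add_submonoid ?U"
    using zero_in_T[of a] unfolding add_submonoid_def by blast
  then show "lucas_S a \<subseteq> ?U"
    unfolding lucas_S_def using generator_in_T by (intro hull_minimal) auto
  have "lucas_T a \<subseteq> lucas_S a"
    unfolding lucas_S_def lucas_T_def by (rule hull_mono) auto
  moreover have L: "?L \<in> lucas_S a"
    unfolding lucas_S_def by (rule hull_inc) auto
  moreover have "?L + (?L + 1) \<in> lucas_S a"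
    using add_in_hull[OF L[unfolded lucas_S_def]] succ calculation(1)
    unfolding lucas_S_def by blast
  ultimately show "?U \<subseteq> lucas_S a"
    by (auto simp: mult_2)
  show "lucas_T a \<inter> {?L, 2 * ?L + 1} \<subseteq> {}"
  proof -
    have "?L \<notin> lucas_T a"
      using T_cases[of ?L a] by (auto simp: lucas_pos[THEN less_imp_neq, symmetric])
    \<comment> \<open>Being below \<open>2 * ?L + 2\<close>, it would have to be a single generator,
      with \<open>lucas n = ?L + 1\<close>.\<close>
    moreover have "2 * ?L + 1 \<notin> lucas_T a"
      using T_cases[of "2 * ?L + 1" a]
      by (auto simp: lucas_neq_Suc_lucas[OF assms, symmetric])
    ultimately show ?thesis by auto
  qed
qed simp

end
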